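(* Let $f_1,\dots,f_T:\mathbb{R}^D\to\mathbb{R}^D$ be differentiable, $s_0\in\mathbb{R}^D$, and let $L$ be the maximum over $t$ of the Lipschitz constants (in spectral norm) of the Jacobians $s\mapsto A_t(s)=\frac{\partial f_t}{\partial s_{t-1}}(s)$. Consider a fixed-point solver with updates $$\mathbf{s}_{1:T}^{(i+1)}=\mathbf{s}_{1:T}^{(i)}-\tilde{\mathbf{J}}(\mathbf{s}_{1:T}^{(i)})^{-1}\mathbf{r}(\mathbf{s}_{1:T}^{(i)}),$$ where $\tilde{\mathbf{J}}(\mathbf{s}_{1:T})\in\mathbb{R}^{TD\times TD}$ is block lower bidiagonal with $I_D$ on the block diagonal and $-\tilde{A}_t(s_{t-1})$ in block position $(t,t-1)$, $2\le t\le T$, for some matrices $\tilde{A}_t(s_{t-1})\in\mathbb{R}^{D\times D}$. Then the error $\mathbf{e}^{(i)}:=\mathbf{s}^{(i)}_{1:T}-\mathbf{s}^\star_{1:T}$ satisfies $$\|\mathbf{e}^{(i+1)}\|_2\le\left\|\tilde{\mathbf{J}}(\mathbf{s}_{1:T}^{(i)})^{-1}\right\|_2\left(\left\|\tilde{\mathbf{J}}(\mathbf{s}_{1:T}^{(i)})-\mathbf{J}(\mathbf{s}_{1:T}^{(i)})\right\|_2\|\mathbf{e}^{(i)}\|_2+\frac{L}{2}\|\mathbf{e}^{(i)}\|_2^2\right).$$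
   Context: The residual $\mathbf{r}:\mathbb{R}^{TD}\to\mathbb{R}^{TD}$ has blocks $r_t(\mathbf{s})=s_t-f_t(s_{t-1})$, $t=1,\dots,T$ ($s_0$ fixed), and $\mathbf{s}^\star_{1:T}$ is its unique zero: $s_1^\star=f_1(s_0)$, $s_t^\star=f_t(s_{t-1}^\star)$. The Jacobian $\mathbf{J}(\mathbf{s})=\frac{\partial\mathbf{r}}{\partial\mathbf{s}}(\mathbf{s})$ is block lower bidiagonal with $I_D$ on the block diagonal and $-A_t(s_{t-1})$ in block position $(t,t-1)$. $\|\cdot\|_2$ is the spectral norm of a matrix and the Euclidean norm of a vector. *)

theory Defs
  imports "HOL-Analysis.Analysis"
begin

text \<open>
  The time index set \<open>{1..T}\<close> is a finite linearly ordered type \<open>'t\<close> with \<open>CARD('t) = T\<close>;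
  every such type is order isomorphic to \<open>{1..T}\<close>. The space of dimension \<open>D\<close> is \<open>real ^ 'd\<close>
  and that of dimension \<open>TD\<close> is \<open>real ^ ('t \<times> 'd)\<close>, so its \<open>norm\<close> is the Euclidean one.
\<close>

definition block :: "real ^ ('t::finite \<times> 'd::finite) \<Rightarrow> 't \<Rightarrow> real ^ 'd" where
  "block s t = (\<chi> i. s $ (t, i))"

definition is_first :: "'t::{finite,linorder} \<Rightarrow> bool" where
  "is_first t \<longleftrightarrow> {..<t} = {}"

text \<open>The index \<open>t - 1\<close>; meaningful only if \<open>\<not> is_first t\<close>.\<close>

definition pred_time :: "'t::{finite,linorder} \<Rightarrow> 't" where
  "pred_time t = Max {..<t}"

text \<open>The state at time \<open>t - 1\<close>, where the state at time \<open>0\<close> is \<open>s0\<close>.\<close>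

definition prev_state ::
  "real ^ 'd::finite \<Rightarrow> real ^ ('t::{finite,linorder} \<times> 'd) \<Rightarrow> 't \<Rightarrow> real ^ 'd" where
  "prev_state s0 s t = (if is_first t then s0 else block s (pred_time t))"

definition residual ::
  "('t::{finite,linorder} \<Rightarrow> real ^ 'd::finite \<Rightarrow> real ^ 'd) \<Rightarrow> real ^ 'd
    \<Rightarrow> real ^ ('t \<times> 'd) \<Rightarrow> real ^ ('t \<times> 'd)" where
  "residual f s0 s = (\<chi> p. case p of (t, i) \<Rightarrow> (block s t - f t (prev_state s0 s t)) $ i)"

text \<open>Well defined by \<open>residual_ex1_zero\<close> below.\<close>

definition solution ::
  "('t::{finite,linorder} \<Rightarrow> real ^ 'd::finite \<Rightarrow> real ^ 'd) \<Rightarrow> real ^ 'd \<Rightarrow> real ^ ('t \<times> 'd)" where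
  "solution f s0 = (THE s. residual f s0 s = 0)"

definition block_bidiagonal ::
  "('t::{finite,linorder} \<Rightarrow> real ^ 'd::finite \<Rightarrow> real ^ 'd ^ 'd) \<Rightarrow> real ^ ('t \<times> 'd)
    \<Rightarrow> real ^ ('t \<times> 'd) ^ ('t \<times> 'd)" where
  "block_bidiagonal B s = (\<chi> p q. case (p, q) of ((t, i), (u, j)) \<Rightarrow>
     if u = t then (mat 1 :: real ^ 'd ^ 'd) $ i $ j
     else if \<not> is_first t \<and> u = pred_time t then (- B t (block s u)) $ i $ j
     else 0)"

definition spectral_norm :: "real ^ 'n ^ 'm \<Rightarrow> real" where
  "spectral_norm M = onorm (\<lambda>x. M *v x)"

text \<open>
  The library's \<open>lipschitz_on\<close> would measure matrices in the Frobenius norm, which is the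
  \<open>norm\<close> of the type \<open>real ^ 'n ^ 'm\<close>.
\<close>

definition spectral_lipschitz :: "real \<Rightarrow> (real ^ 'k \<Rightarrow> real ^ 'n ^ 'm) \<Rightarrow> bool" where
  "spectral_lipschitz C A \<longleftrightarrow> 0 \<le> C \<and> (\<forall>x y. spectral_norm (A x - A y) \<le> C * norm (x - y))"

text \<open>The least Lipschitz constant, provided that \<open>A\<close> is Lipschitz.\<close>

definition lipschitz_const :: "(real ^ 'k \<Rightarrow> real ^ 'n ^ 'm) \<Rightarrow> real" where
  "lipschitz_const A = Inf {C. spectral_lipschitz C A}"

lemma residual_eq_0_iff:
  "residual f s0 s = 0 \<longleftrightarrow> (\<forall>t. block s t = f t (prev_state s0 s t))"
  by (auto simp: residual_def vec_eq_iff)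

lemma pred_time_less:
  fixes t :: "'t::{finite,linorder}"
  assumes "\<not> is_first t"
  shows "pred_time t < t"
proof -
  have "Max {..<t} \<in> {..<t}"
    using assms by (intro Max_in) (auto simp: is_first_def)
  then show ?thesis by (simp add: pred_time_def)
qed

lemma wf_less_finite_linorder: "wf {(u, t :: 't::{finite,linorder}). u < t}"
proof (rule finite_acyclic_wf)
  show "finite {(u, t :: 't). u < t}" by (rule finite)
  show "acyclic {(u, t :: 't). u < t}"
    by (subst acyclic_irrefl, subst trancl_id) (auto simp: trans_def irrefl_def)
qed

lemma residual_ex1_zero:
  fixes f :: "'t::{finite,linorder} \<Rightarrow> real ^ 'd::finite \<Rightarrow> real ^ 'd"
  shows "\<exists>!s. residual f s0 s = 0"
proof -
  define G where "G = (\<lambda>g t. f t (if is_first t then s0 else g (pred_time t)))"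
  define g where "g = wfrec {(u, t :: 't). u < t} G"
  have g: "g t = f t (if is_first t then s0 else g (pred_time t))" for t
    unfolding g_def
    by (subst wfrec[OF wf_less_finite_linorder]) (auto simp: G_def cut_def pred_time_less)
  define s :: "real ^ ('t \<times> 'd)" where "s = (\<chi> p. case p of (t, i) \<Rightarrow> g t $ i)"
  have bs: "block s t = g t" for t
    by (simp add: s_def block_def)
  have ex: "residual f s0 s = 0"
    unfolding residual_eq_0_iff bs prev_state_def using g by auto
  have un: "x = s" if "residual f s0 x = 0" for x
  proof -
    have "block x t = block s t" for t
    proof (induction t rule: wf_induct_rule[OF wf_less_finite_linorder])
      case (1 t)
      then have "prev_state s0 x t = prev_state s0 s t"
        by (auto simp: prev_state_def pred_time_less)
      then show ?case using that ex by (metis residual_eq_0_iff)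
    qed
    then show ?thesis by (auto simp: block_def vec_eq_iff)
  qed
  show ?thesis using ex un by blast
qed

end

theory Submission
  imports Defs
begin

text \<open>
  Fix an iterate \<open>x\<close> and let \<open>e = x - x\<^sup>*\<close>, where \<open>x\<^sup>*\<close> is the zero of the residual \<open>r\<close>. The matrix
  \<open>M\<close> that replaces the Jacobian \<open>J\<close> of \<open>r\<close> at \<open>x\<close> is block unitriangular, hence invertible, and since
  \<open>r(x\<^sup>*) = 0\<close> the new error is
  \<open>e - M\<^sup>-\<^sup>1 r(x) = M\<^sup>-\<^sup>1 ((M - J) e + (r(x\<^sup>*) - r(x) - J (x\<^sup>* - x)))\<close>.
  The first summand in the bracket is bounded by the definition of the spectral norm. The second one
  is the first-order Taylor remainder of \<open>r\<close>. The residual is linear apart from the terms \<open>f\<^sub>t\<close>, so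
  the block of this remainder at time \<open>t\<close> is minus the remainder of \<open>f\<^sub>t\<close> between the states at time
  \<open>t - 1\<close> (and \<open>0\<close> at the first time, where both states are the initial one); it has norm at
  most \<open>L/2\<close> times the squared norm of the block of \<open>e\<close> at time \<open>t - 1\<close>
  (\<open>taylor_remainder_spectral_lipschitz\<close>). The norm of a vector is at most the sum of the norms of its
  blocks, and the squared norms of the blocks of \<open>e\<close> add up to that of \<open>e\<close>, so the whole remainder has
  norm at most \<open>L/2\<close> times the squared norm of \<open>e\<close> (\<open>residual_taylor_remainder\<close>).
\<close>

section \<open>Spectral norm and Lipschitz constants\<close>

lemma norm_matrix_vector_le_spectral_norm:
  fixes M :: "real ^ 'n ^ 'm"
  shows "norm (M *v x) \<le> spectral_norm M * norm x"
  unfolding spectral_norm_def by (rule onorm[OF matrix_vector_mul_bounded_linear])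

lemma spectral_norm_nonneg: "0 \<le> spectral_norm (M :: real ^ 'n ^ 'm)"
  unfolding spectral_norm_def by (rule onorm_pos_le[OF matrix_vector_mul_bounded_linear])

lemma spectral_norm_zero [simp]: "spectral_norm (0 :: real ^ 'n ^ 'm) = 0"
  by (simp add: spectral_norm_def onorm_zero)

text \<open>
  The infimum that defines the Lipschitz constant is attained, because the Lipschitz condition for a
  fixed pair of points is a closed lower bound on the constant.
\<close>

lemma spectral_lipschitz_lipschitz_const:
  assumes "spectral_lipschitz C A"
  shows "spectral_lipschitz (lipschitz_const A) A"
  unfolding spectral_lipschitz_def
proof (intro conjI allI)
  have ne: "{C. spectral_lipschitz C A} \<noteq> {}" using assms by auto
  show "0 \<le> lipschitz_const A"
    unfolding lipschitz_const_def
    by (rule cInf_greatest[OF ne]) (auto simp: spectral_lipschitz_def)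
  fix x y
  show "spectral_norm (A x - A y) \<le> lipschitz_const A * norm (x - y)"
  proof (cases "x = y")
    case False
    then have pos: "0 < norm (x - y)" by simp
    have "spectral_norm (A x - A y) / norm (x - y) \<le> lipschitz_const A"
      unfolding lipschitz_const_def
      by (rule cInf_greatest[OF ne])
        (use pos in \<open>auto simp: spectral_lipschitz_def divide_le_eq\<close>)
    then show ?thesis using pos by (simp add: divide_le_eq)
  qed simp
qed

lemma spectral_lipschitz_mono:
  assumes "spectral_lipschitz C A" "C \<le> C'"
  shows "spectral_lipschitz C' A"
  using assms unfolding spectral_lipschitz_def
  by (meson mult_right_mono norm_ge_zero order_trans)

text \<open>
  Paired with a fixed vector \<open>w\<close>, the remainder along the segment from \<open>x\<close> to \<open>y\<close> is a real function
  of \<open>u \<in> [0, 1]\<close> whose derivative is at most \<open>C u |y - x|\<^sup>2 |w|\<close>. Comparison with the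
  primitive \<open>C/2 u\<^sup>2 |y - x|\<^sup>2 |w|\<close> of this bound replaces integration of the derivative.
  For \<open>w\<close> equal to the remainder itself, the pairing at \<open>u = 1\<close> is \<open>|w|\<^sup>2\<close>, and a factor \<open>|w|\<close> cancels.
\<close>

lemma taylor_remainder_spectral_lipschitz:
  fixes f :: "real ^ 'k \<Rightarrow> real ^ 'm"
  assumes deriv: "\<And>x. (f has_derivative (\<lambda>h. A x *v h)) (at x)"
    and lip: "spectral_lipschitz C A"
  shows "norm (f y - f x - A x *v (y - x)) \<le> C / 2 * (norm (y - x))\<^sup>2"
proof -
  define h where "h = y - x"
  define w where "w = f y - f x - A x *v h"
  define \<phi> where
    "\<phi> = (\<lambda>u. (f (x + u *\<^sub>R h) - f x - u *\<^sub>R (A x *v h)) \<bullet> w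
              - C / 2 * u\<^sup>2 * (norm h)\<^sup>2 * norm w)"
  define \<phi>' where
    "\<phi>' = (\<lambda>u. ((A (x + u *\<^sub>R h) - A x) *v h) \<bullet> w - C * u * (norm h)\<^sup>2 * norm w)"
  have line: "((\<lambda>u. f (x + u *\<^sub>R h)) has_derivative (\<lambda>v. A (x + u *\<^sub>R h) *v (v *\<^sub>R h))) (at u)"
    for u :: real
    by (rule has_derivative_compose[OF _ deriv]) (auto intro!: derivative_eq_intros)
  have d\<phi>: "(\<phi> has_real_derivative \<phi>' u) (at u)" for u
    unfolding \<phi>_def \<phi>'_def has_field_derivative_def
    by (rule derivative_eq_intros line refl | simp)+
      (auto simp: fun_eq_iff algebra_simps inner_diff_left matrix_vector_mult_diff_rdistrib
        matrix_vector_mult_scaleR)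
  have lipD: "spectral_norm (A a - A b) \<le> C * norm (a - b)" for a b
    using lip by (simp add: spectral_lipschitz_def)
  have \<phi>'_le: "\<phi>' u \<le> 0" if "0 \<le> u" for u
  proof -
    have "((A (x + u *\<^sub>R h) - A x) *v h) \<bullet> w \<le> norm ((A (x + u *\<^sub>R h) - A x) *v h) * norm w"
      by (rule norm_cauchy_schwarz)
    also have "\<dots> \<le> (spectral_norm (A (x + u *\<^sub>R h) - A x) * norm h) * norm w"
      by (intro mult_right_mono norm_matrix_vector_le_spectral_norm norm_ge_zero)
    also have "\<dots> \<le> ((C * norm ((x + u *\<^sub>R h) - x)) * norm h) * norm w"
      by (intro mult_right_mono lipD norm_ge_zero)
    also have "\<dots> = C * u * (norm h)\<^sup>2 * norm w"
      using that by (simp add: power2_eq_square)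
    finally show ?thesis by (simp add: \<phi>'_def)
  qed
  have "\<phi> 1 \<le> \<phi> 0"
    by (rule DERIV_nonpos_imp_nonincreasing) (use d\<phi> \<phi>'_le in \<open>simp, blast\<close>)
  then have "norm w * norm w \<le> (C / 2 * (norm h)\<^sup>2) * norm w"
    by (simp add: \<phi>_def w_def h_def flip: power2_eq_square power2_norm_eq_inner)
  then have "norm w \<le> C / 2 * (norm h)\<^sup>2"
    using lip by (cases "w = 0") (auto simp: spectral_lipschitz_def)
  then show ?thesis by (simp add: w_def h_def)
qed

section \<open>Block vectors\<close>

lemma block_diff: "block (x - y) t = block x t - block y t"
  by (simp add: block_def vec_eq_iff)

lemma block_vec_lambda [simp]: "block (\<chi> p. case p of (t, i) \<Rightarrow> g t $ i) t = g t"
  by (simp add: block_def vec_eq_iff)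

lemma bounded_linear_block: "bounded_linear (\<lambda>x. block x t)"
  by (intro linear_conv_bounded_linear[THEN iffD1] linearI) (simp_all add: block_def vec_eq_iff)

lemma sum_norm_block_squared:
  fixes x :: "real ^ ('t::finite \<times> 'd::finite)"
  shows "(\<Sum>t\<in>UNIV. (norm (block x t))\<^sup>2) = (norm x)\<^sup>2"
  by (simp add: norm_vec_def L2_set_def block_def sum_nonneg sum.cartesian_product
      case_prod_unfold)

lemma norm_le_sum_norm_block:
  fixes x :: "real ^ ('t::finite \<times> 'd::finite)"
  shows "norm x \<le> (\<Sum>t\<in>UNIV. norm (block x t))"
proof -
  have "norm x = L2_set (\<lambda>t. norm (block x t)) UNIV"
    by (simp add: L2_set_def sum_norm_block_squared)
  also have "\<dots> \<le> (\<Sum>t\<in>UNIV. norm (block x t))"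
    by (rule L2_set_le_sum) simp
  finally show ?thesis .
qed

lemma inj_on_pred_time: "inj_on pred_time {t. \<not> is_first t}"
proof (rule linorder_inj_onI)
  fix t u :: 'a
  assume "t < u" and t: "t \<in> {t. \<not> is_first t}"
  then have "t \<le> pred_time u" by (auto simp: pred_time_def)
  then show "pred_time t \<noteq> pred_time u" using t pred_time_less[of t] by auto
qed (rule linear)

section \<open>Invertibility of block bidiagonal matrices\<close>

lemma block_block_bidiagonal_mult:
  fixes x s :: "real ^ ('t::{finite,linorder} \<times> 'd::finite)"
  shows "block (block_bidiagonal B s *v x) t =
    block x t - (if is_first t then 0 else B t (block s (pred_time t)) *v block x (pred_time t))"
proof -
  have "(block_bidiagonal B s *v x) $ (t, i) = block x t $ i -
      (if is_first t then 0 else B t (block s (pred_time t)) *v block x (pred_time t)) $ i" for i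
  proof -
    have "(block_bidiagonal B s *v x) $ (t, i)
        = (\<Sum>u\<in>UNIV. \<Sum>j\<in>UNIV. block_bidiagonal B s $ (t, i) $ (u, j) * x $ (u, j))"
      by (simp add: matrix_vector_mult_def sum.cartesian_product case_prod_unfold)
    also have "\<dots> = (\<Sum>u\<in>UNIV. (if u = t then (mat 1 *v block x u) $ i else 0)
        - (if u = pred_time t then
            if is_first t then 0 else (B t (block s u) *v block x u) $ i else 0))"
      using pred_time_less[of t]
      by (intro sum.cong refl)
        (auto simp: block_bidiagonal_def matrix_vector_mult_def block_def sum_negf)
    also have "\<dots> = block x t $ i -
      (if is_first t then 0 else B t (block s (pred_time t)) *v block x (pred_time t)) $ i"
      by (simp add: sum_subtractf)
    finally show ?thesis .
  qed
  then show ?thesis by (simp add: block_def[of "_ *v _"] vec_eq_iff)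
qed

text \<open>
  Forward substitution: an element of the kernel vanishes at the first time, and at any later time
  as soon as it does so one step before.
\<close>

lemma invertible_block_bidiagonal:
  fixes s :: "real ^ ('t::{finite,linorder} \<times> 'd::finite)"
  shows "invertible (block_bidiagonal B s)"
proof -
  have "x = 0" if ker: "block_bidiagonal B s *v x = 0" for x
  proof -
    have "block x t = 0" for t
    proof (induction t rule: wf_induct_rule[OF wf_less_finite_linorder])
      case (1 t)
      have "block (block_bidiagonal B s *v x) t = 0"
        by (simp add: ker block_def vec_eq_iff)
      then show ?case using 1 pred_time_less[of t]
        by (auto simp: block_block_bidiagonal_mult split: if_splits)
    qed
    then show ?thesis by (auto simp: block_def vec_eq_iff)
  qed
  then show ?thesis
    by (simp add: invertible_left_inverse matrix_left_invertible_ker)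
qed

section \<open>The Taylor remainder of the residual\<close>

lemma block_residual: "block (residual f s0 s) t = block s t - f t (prev_state s0 s t)"
  unfolding residual_def by (rule block_vec_lambda)

lemma has_derivative_blockwise:
  fixes F :: "'a::real_normed_vector \<Rightarrow> real ^ ('t::finite \<times> 'd::finite)"
  assumes "\<And>t. ((\<lambda>x. block (F x) t) has_derivative (\<lambda>h. block (F' h) t)) (at x)"
  shows "(F has_derivative F') (at x)"
proof (subst has_derivative_componentwise_within, rule ballI)
  fix b :: "real ^ ('t \<times> 'd)" assume "b \<in> Basis"
  then obtain t i where b: "b = axis (t, i) 1" by (auto simp: Basis_vec_def)
  have "((\<lambda>x. block (F x) t $ i) has_derivative (\<lambda>h. block (F' h) t $ i)) (at x)"
    by (rule bounded_linear.has_derivative[OF bounded_linear_vec_nth assms])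
  then show "((\<lambda>x. F x \<bullet> b) has_derivative (\<lambda>h. F' h \<bullet> b)) (at x)"
    by (simp add: b inner_axis block_def)
qed

text \<open>
  The previous state depends linearly on the trajectory, with a constant added, and its linear part
  is the previous state for the initial state \<open>0\<close>.
\<close>

lemma has_derivative_prev_state:
  fixes s :: "real ^ ('t::{finite,linorder} \<times> 'd::finite)"
  shows "((\<lambda>s. prev_state s0 s t) has_derivative (\<lambda>h. prev_state 0 h t)) (at s)"
  unfolding prev_state_def
  by (cases "is_first t") (auto intro: bounded_linear_imp_has_derivative bounded_linear_block)

lemma prev_state_diff: "prev_state s0 x t - prev_state s0 y t = prev_state 0 (x - y) t"
  by (simp add: prev_state_def block_diff)

lemma has_derivative_residual:
  fixes f :: "'t::{finite,linorder} \<Rightarrow> real ^ 'd::finite \<Rightarrow> real ^ 'd"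
  assumes "\<And>t x. (f t has_derivative (\<lambda>h. A t x *v h)) (at x)"
  shows "(residual f s0 has_derivative
    (\<lambda>h. \<chi> p. case p of (t, i) \<Rightarrow>
      (block h t - A t (prev_state s0 s t) *v prev_state 0 h t) $ i)) (at s)"
proof (rule has_derivative_blockwise)
  fix t
  have "((\<lambda>s. block s t - f t (prev_state s0 s t)) has_derivative
      (\<lambda>h. block h t - A t (prev_state s0 s t) *v prev_state 0 h t)) (at s)"
    by (intro has_derivative_diff bounded_linear_imp_has_derivative bounded_linear_block
        has_derivative_compose[OF has_derivative_prev_state assms])
  then show "((\<lambda>x. block (residual f s0 x) t) has_derivative
      (\<lambda>h. block (\<chi> p. case p of (t, i) \<Rightarrow>
        (block h t - A t (prev_state s0 s t) *v prev_state 0 h t) $ i) t)) (at s)"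
    by (simp only: block_residual block_vec_lambda)
qed

lemma block_jacobian_residual_mult:
  fixes f :: "'t::{finite,linorder} \<Rightarrow> real ^ 'd::finite \<Rightarrow> real ^ 'd"
  assumes "\<And>t x. (f t has_derivative (\<lambda>h. A t x *v h)) (at x)"
  shows "block (jacobian (residual f s0) (at s) *v h) t
    = block h t - A t (prev_state s0 s t) *v prev_state 0 h t"
proof -
  note d = has_derivative_residual[of f A s0 s, OF assms]
  have "(residual f s0 has_derivative (\<lambda>h. jacobian (residual f s0) (at s) *v h)) (at s)"
    by (rule jacobian_works[THEN iffD1, OF differentiableI[OF d]])
  then have "jacobian (residual f s0) (at s) *v h = (\<chi> p. case p of (t, i) \<Rightarrow>
      (block h t - A t (prev_state s0 s t) *v prev_state 0 h t) $ i)"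
    by (rule has_derivative_unique[OF _ d, THEN fun_cong])
  then show ?thesis by (simp only: block_vec_lambda)
qed

text \<open>
  Every block of \<open>x\<close> is the previous state of at most one time, so the squared norms of the
  previous states add up to at most that of \<open>x\<close>.
\<close>

lemma sum_norm_prev_state_squared_le:
  fixes x :: "real ^ ('t::{finite,linorder} \<times> 'd::finite)"
  shows "(\<Sum>t\<in>UNIV. (norm (prev_state 0 x t))\<^sup>2) \<le> (norm x)\<^sup>2"
proof -
  have "(\<Sum>t\<in>UNIV. (norm (prev_state 0 x t))\<^sup>2)
      = (\<Sum>t | \<not> is_first t. (norm (block x (pred_time t)))\<^sup>2)"
    by (rule sum.mono_neutral_cong_right) (auto simp: prev_state_def)
  also have "\<dots> = (\<Sum>t\<in>pred_time ` {t. \<not> is_first t}. (norm (block x t))\<^sup>2)"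
    by (simp add: sum.reindex[OF inj_on_pred_time])
  also have "\<dots> \<le> (\<Sum>t\<in>UNIV. (norm (block x t))\<^sup>2)"
    by (rule sum_mono2) auto
  finally show ?thesis by (simp add: sum_norm_block_squared)
qed

lemma residual_taylor_remainder:
  fixes f :: "'t::{finite,linorder} \<Rightarrow> real ^ 'd::finite \<Rightarrow> real ^ 'd"
  assumes deriv: "\<And>t x. (f t has_derivative (\<lambda>h. A t x *v h)) (at x)"
    and lip: "\<And>t. spectral_lipschitz L (A t)"
  shows "norm (residual f s0 y - residual f s0 x - jacobian (residual f s0) (at x) *v (y - x))
    \<le> L / 2 * (norm (y - x))\<^sup>2"
    (is "norm ?R \<le> _")
proof -
  have "0 \<le> L" using lip by (auto simp: spectral_lipschitz_def)
  have bound: "norm (block ?R t) \<le> L / 2 * (norm (prev_state 0 (y - x) t))\<^sup>2" for t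
  proof -
    let ?x = "prev_state s0 x t" and ?y = "prev_state s0 y t"
    have "block ?R t = - (f t ?y - f t ?x - A t ?x *v (?y - ?x))"
      by (simp add: block_diff block_residual block_jacobian_residual_mult[of f A, OF deriv]
          prev_state_diff)
    then have "norm (block ?R t) = norm (f t ?y - f t ?x - A t ?x *v (?y - ?x))"
      by (simp only: norm_minus_cancel)
    also have "\<dots> \<le> L / 2 * (norm (?y - ?x))\<^sup>2"
      by (rule taylor_remainder_spectral_lipschitz[OF deriv lip])
    finally show ?thesis by (simp add: prev_state_diff)
  qed
  have "norm ?R \<le> (\<Sum>t\<in>UNIV. norm (block ?R t))"
    by (rule norm_le_sum_norm_block)
  also have "\<dots> \<le> (\<Sum>t\<in>UNIV. L / 2 * (norm (prev_state 0 (y - x) t))\<^sup>2)"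
    by (intro sum_mono bound)
  also have "\<dots> = L / 2 * (\<Sum>t\<in>UNIV. (norm (prev_state 0 (y - x) t))\<^sup>2)"
    by (rule sum_distrib_left[symmetric])
  also have "\<dots> \<le> L / 2 * (norm (y - x))\<^sup>2"
    using \<open>0 \<le> L\<close> by (intro mult_left_mono sum_norm_prev_state_squared_le) simp
  finally show ?thesis .
qed

section \<open>The error bound\<close>

lemma residual_solution: "residual f s0 (solution f s0) = 0"
  unfolding solution_def by (rule theI'[OF residual_ex1_zero])

lemma matrix_inv_mult_self:
  assumes "invertible M"
  shows "matrix_inv M ** M = mat 1"
  using someI_ex[OF assms[unfolded invertible_def]] by (simp add: matrix_inv_def)

text \<open>
  The algebra of one quasi-Newton step, separated from the structure of the residual: with \<open>r z = 0\<close>,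
  the new error is the inverse of \<open>M\<close> applied to \<open>M (x - z) - r x\<close>, and adding and subtracting
  \<open>J (x - z)\<close> splits this vector into the effect of the inexact Jacobian and the Taylor remainder.
\<close>

lemma quasi_newton_step_error:
  fixes M J :: "real ^ 'n ^ 'n"
  assumes "invertible M" and zero: "r z = 0"
    and remainder: "norm (r z - r x - J *v (z - x)) \<le> K"
  shows "norm (x - matrix_inv M *v r x - z)
    \<le> spectral_norm (matrix_inv M) * (spectral_norm (M - J) * norm (x - z) + K)"
proof -
  have inv: "matrix_inv M *v (M *v (x - z)) = x - z"
    by (simp only: matrix_vector_mul_assoc matrix_inv_mult_self[OF \<open>invertible M\<close>]
        matrix_vector_mul_lid)
  have split: "M *v (x - z) - r x = (M - J) *v (x - z) + (r z - r x - J *v (z - x))"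
    by (simp add: zero matrix_vector_mult_diff_rdistrib matrix_vector_mult_diff_distrib)
  have "x - matrix_inv M *v r x - z = matrix_inv M *v (M *v (x - z) - r x)"
    unfolding matrix_vector_mult_diff_distrib[of "matrix_inv M"] inv by simp
  also have "\<dots> = matrix_inv M *v ((M - J) *v (x - z) + (r z - r x - J *v (z - x)))"
    unfolding split ..
  finally have "norm (x - matrix_inv M *v r x - z) \<le> spectral_norm (matrix_inv M)
      * norm ((M - J) *v (x - z) + (r z - r x - J *v (z - x)))"
    by (simp only: norm_matrix_vector_le_spectral_norm)
  also have "\<dots> \<le> spectral_norm (matrix_inv M) * (spectral_norm (M - J) * norm (x - z) + K)"
    by (intro mult_left_mono norm_triangle_le add_mono norm_matrix_vector_le_spectral_norm
        remainder spectral_norm_nonneg)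
  finally show ?thesis .
qed

theorem proposition6p3:
  fixes f :: "'t::{finite,linorder} \<Rightarrow> real ^ 'd::finite \<Rightarrow> real ^ 'd"
    and A_tilde :: "'t \<Rightarrow> real ^ 'd \<Rightarrow> real ^ 'd ^ 'd"
    and A :: "'t \<Rightarrow> real ^ 'd \<Rightarrow> real ^ 'd ^ 'd"
    and J J_tilde :: "real ^ ('t \<times> 'd) \<Rightarrow> real ^ ('t \<times> 'd) ^ ('t \<times> 'd)"
    and s0 :: "real ^ 'd"
    and s e :: "nat \<Rightarrow> real ^ ('t \<times> 'd)"
    and L :: real
  assumes differentiable: "\<And>t x. f t differentiable (at x)"
    and A: "\<And>t x. A t x = jacobian (f t) (at x)"
    and lipschitz: "\<And>t. \<exists>C. spectral_lipschitz C (A t)"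
    and L: "L = Max (range (\<lambda>t. lipschitz_const (A t)))"
    and J: "\<And>x. J x = jacobian (residual f s0) (at x)"
    and J_tilde: "\<And>x. J_tilde x = block_bidiagonal A_tilde x"
    and step: "\<And>i. s (Suc i) = s i - matrix_inv (J_tilde (s i)) *v residual f s0 (s i)"
    and e: "\<And>i. e i = s i - solution f s0"
  shows "\<forall>i. norm (e (Suc i))
    \<le> spectral_norm (matrix_inv (J_tilde (s i)))
       * (spectral_norm (J_tilde (s i) - J (s i)) * norm (e i) + L / 2 * (norm (e i))\<^sup>2)"
proof
  fix i
  have deriv: "(f t has_derivative (\<lambda>h. A t x *v h)) (at x)" for t x
    unfolding A by (rule jacobian_works[THEN iffD1, OF differentiable])
  have lip: "spectral_lipschitz L (A t)" for t
  proof -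
    obtain C where "spectral_lipschitz C (A t)" using lipschitz by blast
    then have "spectral_lipschitz (lipschitz_const (A t)) (A t)"
      by (rule spectral_lipschitz_lipschitz_const)
    moreover have "lipschitz_const (A t) \<le> L" unfolding L by (rule Max_ge) auto
    ultimately show ?thesis by (rule spectral_lipschitz_mono)
  qed
  have "norm (residual f s0 (solution f s0) - residual f s0 (s i)
      - J (s i) *v (solution f s0 - s i)) \<le> L / 2 * (norm (e i))\<^sup>2"
    using residual_taylor_remainder[of f A L, OF deriv lip]
    unfolding J e norm_minus_commute[of "s i"] .
  then show "norm (e (Suc i))
    \<le> spectral_norm (matrix_inv (J_tilde (s i)))
       * (spectral_norm (J_tilde (s i) - J (s i)) * norm (e i) + L / 2 * (norm (e i))\<^sup>2)"
    unfolding e step J_tilde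
    by (rule quasi_newton_step_error[where r = "residual f s0",
          OF invertible_block_bidiagonal residual_solution])
qed

end
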